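(* Let $1\leq p\leq\infty$ and let $T=M_wEM_u : L^p(\Sigma)\to L^p(\Sigma)$, $f\mapsto wE(uf)$, be a bounded operator. Then the spectral radius of $T$ is $$r(T)=\|E(uw)\|_{\infty}.$$
   Context: $(X,\Sigma,\mu)$ is a complete $\sigma$-finite measure space and $\mathcal{A}\subseteq\Sigma$ is a sub-$\sigma$-algebra such that $(X,\mathcal{A},\mu|_{\mathcal{A}})$ is $\sigma$-finite. $L^p(\Sigma)=L^p(X,\Sigma,\mu)$ is the complex $L^p$ space; $L^0(\Sigma)$ (resp. $L^0(\mathcal{A})$) is the space of equivalence classes of a.e. finite-valued $\Sigma$-measurable (resp. $\mathcal{A}$-measurable) functions. $E=E^{\mathcal{A}}$ is the conditional expectation operator: for nonnegative measurable $f$, $E(f)$ is the unique $\mathcal{A}$-measurable function with $\int_A f\,d\mu=\int_A E(f)\,d\mu$ for all $A\in\mathcal{A}$, extended linearly to $\mathcal{D}(E)=\{g\in L^0(\Sigma) : E(|g|)\in L^0(\mathcal{A})\}$. The functions $u,w$ are given elements of $\mathcal{D}(E)$, and $M_u$, $M_w$ denote multiplication by $u$, $w$. The spectral radius is $r(T)=\sup\{|\lambda| : \lambda\in\sigma(T)\}$, where $\sigma(T)=\{\lambda\in\mathbb{C} : T-\lambda I\text{ is not invertible}\}$. *)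

theory Defs
  imports "HOL-Probability.Probability"
begin

text \<open>
  The sub-\<open>\<sigma>\<close>-algebra is given by a measure \<open>F\<close> with \<^prop>\<open>subalgebra M F\<close>, of which only the
  measurable sets matter: the measure used on them is that of \<open>M\<close>, as in
  \<^theory>\<open>HOL-Probability.Conditional_Expectation\<close>.  Elements of \<open>L\<^sup>0\<close> and \<open>L\<^sup>p\<close> are represented by
  measurable functions \<^typ>\<open>'a \<Rightarrow> complex\<close>, and equality of classes by equality almost everywhere.
\<close>


subsection \<open>Conditional expectation of complex functions\<close>

definition cond_exp_dom :: "'a measure \<Rightarrow> 'a measure \<Rightarrow> ('a \<Rightarrow> complex) set" where
  "cond_exp_dom M F =
     {g \<in> borel_measurable M. AE x in M. nn_cond_exp M F (\<lambda>y. ennreal (cmod (g y))) x < \<infinity>}"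

text \<open>
  The library function \<^const>\<open>real_cond_exp\<close> is the difference of the conditional expectations of the
  positive and the negative part, so it is meaningful on all of \<^const>\<open>cond_exp_dom\<close>, without
  integrability.
\<close>

definition complex_cond_exp :: "'a measure \<Rightarrow> 'a measure \<Rightarrow> ('a \<Rightarrow> complex) \<Rightarrow> 'a \<Rightarrow> complex" where
  "complex_cond_exp M F g =
     (\<lambda>x. Complex (real_cond_exp M F (\<lambda>y. Re (g y)) x) (real_cond_exp M F (\<lambda>y. Im (g y)) x))"


subsection \<open>The spaces \<open>L\<^sup>p\<close>\<close>

text \<open>
  The second branch is the \<open>p\<close>-th root of the integral; it is spelled out because there is no
  \<^const>\<open>powr\<close> on \<^typ>\<open>ennreal\<close>.
\<close>

definition Lp_norm :: "'a measure \<Rightarrow> ennreal \<Rightarrow> ('a \<Rightarrow> complex) \<Rightarrow> ennreal" where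
  "Lp_norm M p f =
     (if p = \<infinity> then esssup M (\<lambda>x. ennreal (cmod (f x)))
      else let I = (\<integral>\<^sup>+ x. ennreal (cmod (f x) powr enn2real p) \<partial>M)
           in if I = \<infinity> then \<infinity> else ennreal (enn2real I powr (1 / enn2real p)))"

definition Lp :: "'a measure \<Rightarrow> ennreal \<Rightarrow> ('a \<Rightarrow> complex) set" where
  "Lp M p = {f \<in> borel_measurable M. Lp_norm M p f < \<infinity>}"


subsection \<open>Bounded operators on \<open>L\<^sup>p\<close> and their spectrum\<close>

text \<open>
  The second clause says that the operator is well defined on classes modulo null sets.
\<close>

definition Lp_bounded_operator ::
  "'a measure \<Rightarrow> ennreal \<Rightarrow> (('a \<Rightarrow> complex) \<Rightarrow> 'a \<Rightarrow> complex) \<Rightarrow> bool" where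
  "Lp_bounded_operator M p T \<longleftrightarrow>
     (\<forall>f\<in>Lp M p. T f \<in> Lp M p) \<and>
     (\<forall>f\<in>Lp M p. \<forall>g\<in>Lp M p. (AE x in M. f x = g x) \<longrightarrow> (AE x in M. T f x = T g x)) \<and>
     (\<forall>f\<in>Lp M p. \<forall>g\<in>Lp M p. AE x in M. T (\<lambda>y. f y + g y) x = T f x + T g x) \<and>
     (\<forall>c. \<forall>f\<in>Lp M p. AE x in M. T (\<lambda>y. c * f y) x = c * T f x) \<and>
     (\<exists>C\<ge>0. \<forall>f\<in>Lp M p. Lp_norm M p (T f) \<le> ennreal C * Lp_norm M p f)"

text \<open>Invertibility is meant in the algebra of bounded operators on \<open>L\<^sup>p\<close>.\<close>

definition Lp_invertible ::
  "'a measure \<Rightarrow> ennreal \<Rightarrow> (('a \<Rightarrow> complex) \<Rightarrow> 'a \<Rightarrow> complex) \<Rightarrow> bool" where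
  "Lp_invertible M p T \<longleftrightarrow>
     (\<exists>S. Lp_bounded_operator M p S \<and>
        (\<forall>f\<in>Lp M p. (AE x in M. S (T f) x = f x) \<and> (AE x in M. T (S f) x = f x)))"

definition Lp_spectrum ::
  "'a measure \<Rightarrow> ennreal \<Rightarrow> (('a \<Rightarrow> complex) \<Rightarrow> 'a \<Rightarrow> complex) \<Rightarrow> complex set" where
  "Lp_spectrum M p T = {l. \<not> Lp_invertible M p (\<lambda>f x. T f x - l * f x)}"

text \<open>
  As a supremum in \<^typ>\<open>ennreal\<close> this is \<open>0\<close> when the spectrum is empty, which happens only if
  \<open>L\<^sup>p = {0}\<close>.
\<close>

definition Lp_spectral_radius ::
  "'a measure \<Rightarrow> ennreal \<Rightarrow> (('a \<Rightarrow> complex) \<Rightarrow> 'a \<Rightarrow> complex) \<Rightarrow> ennreal" where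
  "Lp_spectral_radius M p T = (SUP l\<in>Lp_spectrum M p T. ennreal (cmod l))"


subsection \<open>Weighted conditional type operators\<close>

definition weighted_cond_exp ::
  "'a measure \<Rightarrow> 'a measure \<Rightarrow> ('a \<Rightarrow> complex) \<Rightarrow> ('a \<Rightarrow> complex) \<Rightarrow> ('a \<Rightarrow> complex) \<Rightarrow> 'a \<Rightarrow> complex" where
  "weighted_cond_exp M F w u f = (\<lambda>x. w x * complex_cond_exp M F (\<lambda>y. u y * f y) x)"

end

theory Submission
  imports Defs
begin

text \<open>
  Write \<open>h = E(uw)\<close>. Since \<open>E\<close> is linear over \<open>\<A>\<close>-measurable functions,
  \<open>T (\<phi> T f) = h \<phi> T f\<close> for every \<open>\<A>\<close>-measurable \<open>\<phi>\<close>, so \<open>T\<close> acts on its range as multiplication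
  by \<open>h\<close>. If \<open>|l| > \<parallel>h\<parallel>\<^sub>\<infinity>\<close>, then \<open>f \<mapsto> (T f / (h - l) - f) / l\<close> is therefore a bounded inverse of
  \<open>T - l\<close>. Conversely, let \<open>z \<noteq> 0\<close> be in the essential range of \<open>h\<close>. For \<open>C \<in> \<A>\<close> of finite measure,
  \<open>g = T (1\<^sub>C cnj (sgn u)) = 1\<^sub>C w E|u|\<close> lies in \<open>L\<^sup>p\<close>, and if \<open>C \<subseteq> {|h - z| < e}\<close> then
  \<open>|T g - z g| \<le> e |g|\<close>; some such \<open>g\<close> is nonzero, because otherwise \<open>uw\<close>, and so \<open>h\<close>, would vanish on
  \<open>{|h - z| < e}\<close>. So \<open>T - z\<close> is not bounded below. The same functions \<open>g\<close> show
  that \<open>E|uw|\<close> is finite: \<open>ug\<close> is in the domain of \<open>E\<close>, that is, \<open>E|u| E|uw|\<close> is finite.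
\<close>

subsection \<open>Conditional expectation without integrability\<close>

context sigma_finite_subalgebra
begin

text \<open>With \<open>d = a - b\<close>, the identity \<open>d^+ + b = d^- + a\<close> has
  nonnegative terms only, so additivity of \<open>nn_cond_exp\<close> applies, and the finite terms
  may then be subtracted. This frees \<open>real_cond_exp\<close> from the canonical splitting into
  positive and negative part, which is compatible neither with sums nor with products.\<close>

lemma real_cond_exp_diff_nonneg:
  fixes a b :: "'a \<Rightarrow> real"
  assumes [measurable]: "a \<in> borel_measurable M" "b \<in> borel_measurable M"
    and nonneg: "\<And>x. 0 \<le> a x" "\<And>x. 0 \<le> b x"
    and fin: "AE x in M. nn_cond_exp M F (\<lambda>y. ennreal (a y)) x < \<infinity>"
      "AE x in M. nn_cond_exp M F (\<lambda>y. ennreal (b y)) x < \<infinity>"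
  shows "AE x in M. real_cond_exp M F (\<lambda>y. a y - b y) x =
    enn2real (nn_cond_exp M F (\<lambda>y. ennreal (a y)) x) - enn2real (nn_cond_exp M F (\<lambda>y. ennreal (b y)) x)"
proof -
  let ?E = "\<lambda>f. nn_cond_exp M F (\<lambda>y. ennreal (f y))"
  \<comment> \<open>\<open>ennreal\<close> sends negative reals to 0, so
    \<open>ennreal (a y - b y)\<close> is the positive part and
    \<open>ennreal (- (a y - b y))\<close> the negative part of the difference.\<close>
  have "(\<lambda>y. ennreal (a y - b y) + ennreal (b y)) = (\<lambda>y. ennreal (- (a y - b y)) + ennreal (a y))"
  proof
    fix y
    show "ennreal (a y - b y) + ennreal (b y) = ennreal (- (a y - b y)) + ennreal (a y)"
      using nonneg[of y] by (cases "b y \<le> a y") (simp_all add: ennreal_neg flip: ennreal_plus)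
  qed
  moreover have "AE x in M. ?E (\<lambda>y. a y - b y) x + ?E b x =
      nn_cond_exp M F (\<lambda>y. ennreal (a y - b y) + ennreal (b y)) x"
    by (rule nn_cond_exp_sum) measurable
  moreover have "AE x in M. ?E (\<lambda>y. - (a y - b y)) x + ?E a x =
      nn_cond_exp M F (\<lambda>y. ennreal (- (a y - b y)) + ennreal (a y)) x"
    by (rule nn_cond_exp_sum) measurable
  ultimately have "AE x in M. ?E (\<lambda>y. a y - b y) x + ?E b x = ?E (\<lambda>y. - (a y - b y)) x + ?E a x"
    by auto
  \<comment> \<open>The positive part is dominated by \<open>a\<close> and the negative part by
    \<open>b\<close>, so all four expectations are finite and \<open>enn2real\<close> is additive on
    them.\<close>
  moreover have "AE x in M. ?E (\<lambda>y. a y - b y) x \<le> ?E a x"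
    by (rule nn_cond_exp_mono) (auto intro!: ennreal_leI simp: nonneg)
  moreover have "AE x in M. ?E (\<lambda>y. - (a y - b y)) x \<le> ?E b x"
    by (rule nn_cond_exp_mono) (auto intro!: ennreal_leI simp: nonneg)
  ultimately show ?thesis
    using fin
  proof eventually_elim
    case (elim x)
    then have fin': "?E (\<lambda>y. a y - b y) x < top" "?E (\<lambda>y. - (a y - b y)) x < top" "?E a x < top" "?E b x < top"
      by (auto intro: le_less_trans)
    then have "enn2real (?E (\<lambda>y. a y - b y) x) + enn2real (?E b x) =
        enn2real (?E (\<lambda>y. - (a y - b y)) x) + enn2real (?E a x)"
      using elim(1) by (metis enn2real_plus)
    then show ?case
      by (simp add: real_cond_exp_def)
  qed
qed

lemma nn_cond_exp_finite_mono:
  assumes "AE x in M. f x \<le> g x" "AE x in M. nn_cond_exp M F g x < \<infinity>"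
    and [measurable]: "f \<in> borel_measurable M" "g \<in> borel_measurable M"
  shows "AE x in M. nn_cond_exp M F f x < \<infinity>"
proof -
  have "AE x in M. nn_cond_exp M F f x \<le> nn_cond_exp M F g x"
    using assms by (intro nn_cond_exp_mono)
  then show ?thesis
    using assms(2) by eventually_elim (rule le_less_trans)
qed

lemma nn_cond_exp_finite_mult:
  assumes [measurable]: "f \<in> borel_measurable F" "g \<in> borel_measurable M"
    and "AE x in M. f x < \<infinity>" "AE x in M. nn_cond_exp M F g x < \<infinity>"
  shows "AE x in M. nn_cond_exp M F (\<lambda>y. f y * g y) x < \<infinity>"
  using nn_cond_exp_prod[OF assms(1,2)] assms(3,4)
  by eventually_elim (metis ennreal_mult_less_top infinity_ennreal_def)

lemma nn_cond_exp_finite_add: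
  assumes [measurable]: "f \<in> borel_measurable M" "g \<in> borel_measurable M"
    and "AE x in M. nn_cond_exp M F f x < \<infinity>" "AE x in M. nn_cond_exp M F g x < \<infinity>"
  shows "AE x in M. nn_cond_exp M F (\<lambda>y. f y + g y) x < \<infinity>"
  using nn_cond_exp_sum[OF assms(1,2)] assms(3,4)
  by eventually_elim (metis ennreal_add_less_top infinity_ennreal_def)

text \<open>Apply \<open>real_cond_exp_diff_nonneg\<close> to \<open>f + g = a - b\<close>, where
  \<open>a\<close> is the sum of the positive parts and \<open>b\<close> that of the negative parts;
  both have finite conditional expectation.\<close>

lemma real_cond_exp_add':
  fixes f g :: "'a \<Rightarrow> real"
  assumes [measurable]: "f \<in> borel_measurable M" "g \<in> borel_measurable M"
    and fin: "AE x in M. nn_cond_exp M F (\<lambda>y. ennreal \<bar>f y\<bar>) x < \<infinity>"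
      "AE x in M. nn_cond_exp M F (\<lambda>y. ennreal \<bar>g y\<bar>) x < \<infinity>"
  shows "AE x in M. real_cond_exp M F (\<lambda>y. f y + g y) x = real_cond_exp M F f x + real_cond_exp M F g x"
proof -
  let ?E = "nn_cond_exp M F"
  define a where "a = (\<lambda>y. max 0 (f y) + max 0 (g y))"
  define b where "b = (\<lambda>y. max 0 (- f y) + max 0 (- g y))"
  have [measurable]: "a \<in> borel_measurable M" "b \<in> borel_measurable M"
    by (auto simp: a_def b_def)
  have eq: "(\<lambda>y. ennreal (a y)) = (\<lambda>y. ennreal (f y) + ennreal (g y))"
      "(\<lambda>y. ennreal (b y)) = (\<lambda>y. ennreal (- f y) + ennreal (- g y))"
    by (auto simp: a_def b_def)
  have parts: "AE x in M. ?E (\<lambda>y. ennreal (f y)) x < \<infinity>" "AE x in M. ?E (\<lambda>y. ennreal (- f y)) x < \<infinity>"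
    "AE x in M. ?E (\<lambda>y. ennreal (g y)) x < \<infinity>" "AE x in M. ?E (\<lambda>y. ennreal (- g y)) x < \<infinity>"
    by (rule nn_cond_exp_finite_mono[OF _ fin(1)] nn_cond_exp_finite_mono[OF _ fin(2)];
        auto intro!: ennreal_leI)+
  have "AE x in M. ?E (\<lambda>y. ennreal (f y)) x + ?E (\<lambda>y. ennreal (g y)) x = ?E (\<lambda>y. ennreal (a y)) x"
    unfolding eq by (rule nn_cond_exp_sum) measurable
  moreover have "AE x in M. ?E (\<lambda>y. ennreal (- f y)) x + ?E (\<lambda>y. ennreal (- g y)) x = ?E (\<lambda>y. ennreal (b y)) x"
    unfolding eq by (rule nn_cond_exp_sum) measurable
  moreover have "AE x in M. real_cond_exp M F (\<lambda>y. a y - b y) x =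
      enn2real (?E (\<lambda>y. ennreal (a y)) x) - enn2real (?E (\<lambda>y. ennreal (b y)) x)"
    by (rule real_cond_exp_diff_nonneg)
      (use nn_cond_exp_finite_add parts in \<open>auto simp: eq\<close>, auto simp: a_def b_def)
  moreover have "(\<lambda>y. a y - b y) = (\<lambda>y. f y + g y)"
    by (auto simp: a_def b_def max_def)
  ultimately have "AE x in M. real_cond_exp M F (\<lambda>y. f y + g y) x =
      enn2real (?E (\<lambda>y. ennreal (f y)) x + ?E (\<lambda>y. ennreal (g y)) x) -
      enn2real (?E (\<lambda>y. ennreal (- f y)) x + ?E (\<lambda>y. ennreal (- g y)) x)"
    by auto
  then show ?thesis
    using parts by eventually_elim (simp add: real_cond_exp_def enn2real_plus)
qed

text \<open>Multiplying out \<open>(f^+ - f^-) (g^+ - g^-)\<close> gives a difference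
  \<open>a - b\<close> of nonnegative functions, and in each of the four products the factor from
  \<open>f\<close> can be pulled out of \<open>nn_cond_exp\<close>.\<close>

lemma real_cond_exp_mult':
  fixes f g :: "'a \<Rightarrow> real"
  assumes [measurable]: "f \<in> borel_measurable F" "g \<in> borel_measurable M"
    and fin: "AE x in M. nn_cond_exp M F (\<lambda>y. ennreal \<bar>g y\<bar>) x < \<infinity>"
  shows "AE x in M. real_cond_exp M F (\<lambda>y. f y * g y) x = f x * real_cond_exp M F g x"
proof -
  let ?E = "nn_cond_exp M F"
  define a where "a = (\<lambda>y. max 0 (f y) * max 0 (g y) + max 0 (- f y) * max 0 (- g y))"
  define b where "b = (\<lambda>y. max 0 (f y) * max 0 (- g y) + max 0 (- f y) * max 0 (g y))"
  have [measurable]: "f \<in> borel_measurable M"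
    using assms(1) by (rule measurable_from_subalg[OF subalg])
  have [measurable]: "a \<in> borel_measurable M" "b \<in> borel_measurable M"
    by (auto simp: a_def b_def)
  have eq: "(\<lambda>y. ennreal (a y)) = (\<lambda>y. ennreal (f y) * ennreal (g y) + ennreal (- f y) * ennreal (- g y))"
      "(\<lambda>y. ennreal (b y)) = (\<lambda>y. ennreal (f y) * ennreal (- g y) + ennreal (- f y) * ennreal (g y))"
    by (auto simp: a_def b_def ennreal_mult)
  have parts: "AE x in M. ?E (\<lambda>y. ennreal (g y)) x < \<infinity>" "AE x in M. ?E (\<lambda>y. ennreal (- g y)) x < \<infinity>"
    by (rule nn_cond_exp_finite_mono[OF _ fin]; auto intro!: ennreal_leI)+
  have fina: "AE x in M. ?E (\<lambda>y. ennreal (a y)) x < \<infinity>"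
    unfolding eq by (intro nn_cond_exp_finite_add nn_cond_exp_finite_mult parts) auto
  have finb: "AE x in M. ?E (\<lambda>y. ennreal (b y)) x < \<infinity>"
    unfolding eq by (intro nn_cond_exp_finite_add nn_cond_exp_finite_mult parts) auto
  have neg: "(\<lambda>y. - f y) \<in> borel_measurable F" "(\<lambda>y. - g y) \<in> borel_measurable M"
    by measurable
  have prod: "AE x in M. ennreal (f' x) * ?E (\<lambda>y. ennreal (g' y)) x = ?E (\<lambda>y. ennreal (f' y) * ennreal (g' y)) x"
    if [measurable]: "f' \<in> borel_measurable F" "g' \<in> borel_measurable M" for f' g' :: "'a \<Rightarrow> real"
    by (rule nn_cond_exp_prod) measurable
  have "AE x in M. ?E (\<lambda>y. ennreal (f y) * ennreal (g y)) x + ?E (\<lambda>y. ennreal (- f y) * ennreal (- g y)) x =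
      ?E (\<lambda>y. ennreal (a y)) x"
    unfolding eq by (rule nn_cond_exp_sum) measurable
  moreover have "AE x in M. ?E (\<lambda>y. ennreal (f y) * ennreal (- g y)) x + ?E (\<lambda>y. ennreal (- f y) * ennreal (g y)) x =
      ?E (\<lambda>y. ennreal (b y)) x"
    unfolding eq by (rule nn_cond_exp_sum) measurable
  moreover have "AE x in M. real_cond_exp M F (\<lambda>y. f y * g y) x =
      enn2real (?E (\<lambda>y. ennreal (a y)) x) - enn2real (?E (\<lambda>y. ennreal (b y)) x)"
  proof -
    have "(\<lambda>y. f y * g y) = (\<lambda>y. a y - b y)"
      by (auto simp: a_def b_def max_def)
    then show ?thesis
      using real_cond_exp_diff_nonneg[OF _ _ _ _ fina finb] by (auto simp: a_def b_def)
  qed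
  ultimately have "AE x in M. real_cond_exp M F (\<lambda>y. f y * g y) x =
      enn2real (ennreal (f x) * ?E (\<lambda>y. ennreal (g y)) x + ennreal (- f x) * ?E (\<lambda>y. ennreal (- g y)) x) -
      enn2real (ennreal (f x) * ?E (\<lambda>y. ennreal (- g y)) x + ennreal (- f x) * ?E (\<lambda>y. ennreal (g y)) x)"
    using prod[OF assms(1,2)] prod[OF assms(1) neg(2)] prod[OF neg(1) assms(2)] prod[OF neg]
    by eventually_elim simp
  then show ?thesis
    using parts
  proof eventually_elim
    case (elim x)
    show ?case
      unfolding elim(1)
      \<comment> \<open>For either sign of \<open>f x\<close>, one of \<open>ennreal (f x)\<close>
        and \<open>ennreal (- f x)\<close> is 0, so each \<open>enn2real\<close> is applied to a
        single product.\<close>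
      by (cases "0 \<le> f x")
        (simp_all add: real_cond_exp_def enn2real_mult ennreal_neg algebra_simps)
  qed
qed

lemma real_cond_exp_cong':
  fixes f g :: "'a \<Rightarrow> real"
  assumes ae: "AE x in M. f x = g x"
    and [measurable]: "f \<in> borel_measurable M" "g \<in> borel_measurable M"
  shows "AE x in M. real_cond_exp M F f x = real_cond_exp M F g x"
proof -
  have "AE x in M. nn_cond_exp M F (\<lambda>y. ennreal (f y)) x = nn_cond_exp M F (\<lambda>y. ennreal (g y)) x"
    by (rule nn_cond_exp_cong) (use ae in auto)
  moreover have "AE x in M. nn_cond_exp M F (\<lambda>y. ennreal (- f y)) x = nn_cond_exp M F (\<lambda>y. ennreal (- g y)) x"
    by (rule nn_cond_exp_cong) (use ae in auto)
  ultimately show ?thesis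
    by eventually_elim (simp add: real_cond_exp_def)
qed

text \<open>The set where \<open>E g = 0\<close> is measurable for \<open>F\<close>, so
  \<open>g\<close> and \<open>E g\<close> have the same integral over it, namely 0.\<close>

lemma nn_cond_exp_eq_0_imp:
  assumes [measurable]: "g \<in> borel_measurable M"
  shows "AE x in M. nn_cond_exp M F g x = 0 \<longrightarrow> g x = 0"
proof -
  let ?Z = "\<lambda>x. if nn_cond_exp M F g x = 0 then 1 else 0 :: ennreal"
  have "(\<integral>\<^sup>+ x. ?Z x * g x \<partial>M) = (\<integral>\<^sup>+ x. ?Z x * nn_cond_exp M F g x \<partial>M)"
    by (rule nn_cond_exp_intg[symmetric]) measurable
  also have "\<dots> = (\<integral>\<^sup>+ x. 0 \<partial>M)"
    by (rule nn_integral_cong) auto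
  finally have "AE x in M. ?Z x * g x = 0"
    using nn_integral_0_iff_AE[of "\<lambda>x. ?Z x * g x" M] by simp
  then show ?thesis
    by eventually_elim (auto split: if_splits)
qed

section \<open>Complex conditional expectation and its linearity over \<open>F\<close>-measurable
  functions\<close>

lemma complex_cond_exp_measurable [measurable]:
  "complex_cond_exp M F g \<in> borel_measurable F" "complex_cond_exp M F g \<in> borel_measurable M"
proof -
  show "complex_cond_exp M F g \<in> borel_measurable F"
    unfolding complex_cond_exp_def by (subst borel_measurable_complex_iff) simp
  then show "complex_cond_exp M F g \<in> borel_measurable M"
    by (rule measurable_from_subalg[OF subalg])
qed

lemma complex_cond_exp_cong:
  assumes ae: "AE x in M. f x = g x"
    and [measurable]: "f \<in> borel_measurable M" "g \<in> borel_measurable M"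
  shows "AE x in M. complex_cond_exp M F f x = complex_cond_exp M F g x"
proof -
  have "AE x in M. real_cond_exp M F (\<lambda>y. Re (f y)) x = real_cond_exp M F (\<lambda>y. Re (g y)) x"
    by (rule real_cond_exp_cong') (use ae in auto)
  moreover have "AE x in M. real_cond_exp M F (\<lambda>y. Im (f y)) x = real_cond_exp M F (\<lambda>y. Im (g y)) x"
    by (rule real_cond_exp_cong') (use ae in auto)
  ultimately show ?thesis
    by eventually_elim (simp add: complex_cond_exp_def)
qed

text \<open>The real and the imaginary part of \<open>\<phi> g\<close> are both combinations of
  \<open>Re g\<close> and \<open>Im g\<close> with real \<open>F\<close>-measurable coefficients;
  \<open>comb\<close> treats the two at once.\<close>

lemma complex_cond_exp_mult:
  assumes [measurable]: "\<phi> \<in> borel_measurable F" and g: "g \<in> cond_exp_dom M F"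
  shows "AE x in M. complex_cond_exp M F (\<lambda>y. \<phi> y * g y) x = \<phi> x * complex_cond_exp M F g x"
proof -
  have [measurable]: "g \<in> borel_measurable M" "\<phi> \<in> borel_measurable M"
    using g measurable_from_subalg[OF subalg assms(1)] by (auto simp: cond_exp_dom_def)
  have fin: "AE x in M. nn_cond_exp M F (\<lambda>y. ennreal (cmod (g y))) x < \<infinity>"
    using g by (simp add: cond_exp_dom_def)
  have finR: "AE x in M. nn_cond_exp M F (\<lambda>y. ennreal \<bar>Re (g y)\<bar>) x < \<infinity>"
    by (rule nn_cond_exp_finite_mono[OF _ fin]) (auto intro!: ennreal_leI abs_Re_le_cmod)
  have finI: "AE x in M. nn_cond_exp M F (\<lambda>y. ennreal \<bar>Im (g y)\<bar>) x < \<infinity>"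
    by (rule nn_cond_exp_finite_mono[OF _ fin]) (auto intro!: ennreal_leI abs_Im_le_cmod)
  have prod_fin: "AE x in M. nn_cond_exp M F (\<lambda>y. ennreal \<bar>a y * b y\<bar>) x < \<infinity>"
    if [measurable]: "a \<in> borel_measurable F" "b \<in> borel_measurable M"
      and "AE x in M. nn_cond_exp M F (\<lambda>y. ennreal \<bar>b y\<bar>) x < \<infinity>" for a b :: "'a \<Rightarrow> real"
    unfolding abs_mult ennreal_mult[OF abs_ge_zero abs_ge_zero]
    by (rule nn_cond_exp_finite_mult) (use that in auto)
  have comb: "AE x in M. real_cond_exp M F (\<lambda>y. a y * Re (g y) + b y * Im (g y)) x =
      a x * real_cond_exp M F (\<lambda>y. Re (g y)) x + b x * real_cond_exp M F (\<lambda>y. Im (g y)) x"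
    if [measurable]: "a \<in> borel_measurable F" "b \<in> borel_measurable F" for a b
  proof -
    have [measurable]: "a \<in> borel_measurable M" "b \<in> borel_measurable M"
      using that by (auto intro: measurable_from_subalg[OF subalg])
    have "AE x in M. real_cond_exp M F (\<lambda>y. a y * Re (g y) + b y * Im (g y)) x =
        real_cond_exp M F (\<lambda>y. a y * Re (g y)) x + real_cond_exp M F (\<lambda>y. b y * Im (g y)) x"
      by (rule real_cond_exp_add') (use prod_fin finR finI in auto)
    moreover have "AE x in M. real_cond_exp M F (\<lambda>y. a y * Re (g y)) x = a x * real_cond_exp M F (\<lambda>y. Re (g y)) x"
      by (rule real_cond_exp_mult') (use finR in auto)
    moreover have "AE x in M. real_cond_exp M F (\<lambda>y. b y * Im (g y)) x = b x * real_cond_exp M F (\<lambda>y. Im (g y)) x"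
      by (rule real_cond_exp_mult') (use finI in auto)
    ultimately show ?thesis
      by eventually_elim simp
  qed
  have "AE x in M. real_cond_exp M F (\<lambda>y. Re (\<phi> y * g y)) x =
      Re (\<phi> x) * real_cond_exp M F (\<lambda>y. Re (g y)) x - Im (\<phi> x) * real_cond_exp M F (\<lambda>y. Im (g y)) x"
    using comb[of "\<lambda>y. Re (\<phi> y)" "\<lambda>y. - Im (\<phi> y)"] by simp
  moreover have "AE x in M. real_cond_exp M F (\<lambda>y. Im (\<phi> y * g y)) x =
      Im (\<phi> x) * real_cond_exp M F (\<lambda>y. Re (g y)) x + Re (\<phi> x) * real_cond_exp M F (\<lambda>y. Im (g y)) x"
    using comb[of "\<lambda>y. Im (\<phi> y)" "\<lambda>y. Re (\<phi> y)"] by (simp add: add.commute)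
  ultimately show ?thesis
    by eventually_elim (simp add: complex_cond_exp_def complex_eq_iff)
qed

lemma complex_cond_exp_of_real_nonneg:
  assumes [measurable]: "g \<in> borel_measurable M" and "\<And>x. 0 \<le> g x"
  shows "AE x in M. complex_cond_exp M F (\<lambda>y. complex_of_real (g y)) x =
    complex_of_real (enn2real (nn_cond_exp M F (\<lambda>y. ennreal (g y)) x))"
proof -
  have "AE x in M. 0 = nn_cond_exp M F (\<lambda>_. 0) x"
    by (rule nn_cond_exp_F_meas) simp
  moreover have "(\<lambda>y. ennreal (- g y)) = (\<lambda>_. 0)"
    using assms(2) by (simp add: ennreal_neg)
  ultimately show ?thesis
    by (auto simp: complex_cond_exp_def real_cond_exp_def complex_eq_iff)
qed

end


subsection \<open>The spaces \<open>L\<^sup>p\<close>\<close>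

lemma esssup_cmod_le:
  assumes [measurable]: "f \<in> borel_measurable M" and "0 \<le> K"
    and "AE x in M. cmod (f x) \<le> K * cmod (g x)"
  shows "Lp_norm M \<infinity> f \<le> ennreal K * Lp_norm M \<infinity> g"
proof -
  have "AE x in M. ennreal (cmod (f x)) \<le> ennreal K * esssup M (\<lambda>x. ennreal (cmod (g x)))"
    using assms(3) esssup_AE[of "\<lambda>x. ennreal (cmod (g x))" M]
  proof eventually_elim
    case (elim x)
    have "ennreal (cmod (f x)) \<le> ennreal K * ennreal (cmod (g x))"
      using elim(1) \<open>0 \<le> K\<close> by (simp add: ennreal_leI flip: ennreal_mult)
    then show ?case
      using elim(2) by (meson mult_left_mono order_trans zero_le)
  qed
  then show ?thesis
    by (auto simp: Lp_norm_def intro!: esssup_I)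
qed

text \<open>The \<open>q\<close>-th root on the extended half-line, split off from the finite branch
  of \<open>Lp_norm\<close> so that monotonicity and homogeneity can be stated. Infinity is a
  separate case because \<open>enn2real\<close> sends it to 0.\<close>

definition ennroot :: "real \<Rightarrow> ennreal \<Rightarrow> ennreal" where
  "ennroot q I = (if I = \<infinity> then \<infinity> else ennreal (enn2real I powr (1 / q)))"

lemma ennroot_mono:
  assumes "0 < q" "I \<le> J"
  shows "ennroot q I \<le> ennroot q J"
proof (cases "J = \<infinity>")
  case False
  then have "I < \<infinity>" "J < \<infinity>"
    using assms(2) by (auto simp: top.not_eq_extremum intro: le_less_trans)
  then show ?thesis
    using assms by (auto simp: ennroot_def intro!: ennreal_leI powr_mono2 enn2real_mono)
qed (simp add: ennroot_def)

lemma ennroot_mult: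
  assumes "0 < q" "0 < K"
  shows "ennroot q (ennreal (K powr q) * I) = ennreal K * ennroot q I"
proof (cases "I = \<infinity>")
  case True
  then show ?thesis
    using assms by (simp add: ennroot_def ennreal_mult_top)
next
  case False
  then have "ennreal (K powr q) * I \<noteq> \<infinity>"
    by (simp add: ennreal_mult_eq_top_iff)
  then show ?thesis
    using False assms
    by (simp add: ennroot_def enn2real_mult powr_mult powr_powr flip: ennreal_mult)
qed

lemma Lp_norm_eq_ennroot:
  "p \<noteq> \<infinity> \<Longrightarrow>
    Lp_norm M p f = ennroot (enn2real p) (\<integral>\<^sup>+ x. ennreal (cmod (f x) powr enn2real p) \<partial>M)"
  by (simp add: Lp_norm_def ennroot_def Let_def)

lemma enn2real_ge_1:
  assumes "1 \<le> p" "p \<noteq> \<infinity>"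
  shows "1 \<le> enn2real p"
  using enn2real_mono[OF assms(1)] assms(2) by (simp add: top.not_eq_extremum)

lemma Lp_norm_le:
  assumes p: "1 \<le> p" and [measurable]: "f \<in> borel_measurable M" "g \<in> borel_measurable M"
    and K: "0 < K" and le: "AE x in M. cmod (f x) \<le> K * cmod (g x)"
  shows "Lp_norm M p f \<le> ennreal K * Lp_norm M p g"
proof (cases "p = \<infinity>")
  case True
  then show ?thesis
    using esssup_cmod_le[OF _ _ le] K by simp
next
  case False
  define q where "q = enn2real p"
  have q: "0 < q"
    using enn2real_ge_1[OF p False] by (simp add: q_def)
  have "(\<integral>\<^sup>+ x. ennreal (cmod (f x) powr q) \<partial>M) \<le>
      (\<integral>\<^sup>+ x. ennreal (K powr q) * ennreal (cmod (g x) powr q) \<partial>M)"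
    using le
  proof (intro nn_integral_mono_AE, eventually_elim)
    case (elim x)
    have "cmod (f x) powr q \<le> (K * cmod (g x)) powr q"
      using elim q by (intro powr_mono2) auto
    then show ?case
      using K by (simp add: powr_mult ennreal_leI flip: ennreal_mult)
  qed
  also have "\<dots> = ennreal (K powr q) * (\<integral>\<^sup>+ x. ennreal (cmod (g x) powr q) \<partial>M)"
    by (rule nn_integral_cmult) measurable
  finally show ?thesis
    using ennroot_mono[OF q] ennroot_mult[OF q K] by (metis Lp_norm_eq_ennroot[OF False] q_def)
qed

lemma Lp_norm_eq_0_imp:
  assumes p: "1 \<le> p" and [measurable]: "f \<in> borel_measurable M" and zero: "Lp_norm M p f = 0"
  shows "AE x in M. f x = 0"
proof (cases "p = \<infinity>")
  case True
  then have "AE x in M. ennreal (cmod (f x)) \<le> 0"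
    using zero esssup_AE[of "\<lambda>x. ennreal (cmod (f x))" M] by (simp add: Lp_norm_def)
  then show ?thesis
    by eventually_elim simp
next
  case False
  then have "(\<integral>\<^sup>+ x. ennreal (cmod (f x) powr enn2real p) \<partial>M) = 0"
    using zero enn2real_ge_1[OF p False]
    by (auto simp: Lp_norm_def Let_def enn2real_eq_0_iff split: if_splits)
  then have "AE x in M. ennreal (cmod (f x) powr enn2real p) = 0"
    by (subst (asm) nn_integral_0_iff_AE) auto
  then show ?thesis
    by eventually_elim simp
qed

text \<open>Boundedness is all that matters here, so this crude constant replaces Minkowski's inequality.\<close>

lemma Lp_norm_add_le:
  assumes p: "1 \<le> p" and [measurable]: "f \<in> borel_measurable M" "g \<in> borel_measurable M"
  shows "Lp_norm M p (\<lambda>x. f x + g x) \<le> 4 * max (Lp_norm M p f) (Lp_norm M p g)"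
proof (cases "p = \<infinity>")
  case True
  let ?N = "max (Lp_norm M p f) (Lp_norm M p g)"
  have "AE x in M. ennreal (cmod (f x + g x)) \<le> 4 * ?N"
    using esssup_AE[of "\<lambda>x. ennreal (cmod (f x))" M] esssup_AE[of "\<lambda>x. ennreal (cmod (g x))" M]
  proof eventually_elim
    case (elim x)
    have "ennreal (cmod (f x + g x)) \<le> ennreal (cmod (f x)) + ennreal (cmod (g x))"
      by (simp add: norm_triangle_ineq ennreal_leI flip: ennreal_plus)
    also have "\<dots> \<le> ?N + ?N"
      using elim True by (intro add_mono) (auto simp: Lp_norm_def le_max_iff_disj)
    also have "\<dots> = 2 * ?N"
      by (simp add: mult_2)
    also have "\<dots> \<le> 4 * ?N"
      by (intro mult_right_mono) auto
    finally show ?case .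
  qed
  then show ?thesis
    using True by (auto simp: Lp_norm_def intro!: esssup_I)
next
  case False
  define q where "q = enn2real p"
  have q: "1 \<le> q"
    using enn2real_ge_1[OF p False] by (simp add: q_def)
  let ?I = "\<lambda>f. \<integral>\<^sup>+ x. ennreal (cmod (f x) powr q) \<partial>M"
  have "?I (\<lambda>x. f x + g x) \<le>
      (\<integral>\<^sup>+ x. ennreal (2 powr q) * (ennreal (cmod (f x) powr q) + ennreal (cmod (g x) powr q)) \<partial>M)"
  proof (rule nn_integral_mono)
    fix x
    have "cmod (f x + g x) powr q \<le> (2 * max (cmod (f x)) (cmod (g x))) powr q"
      using q norm_triangle_ineq[of "f x" "g x"] by (intro powr_mono2) auto
    also have "\<dots> = 2 powr q * max (cmod (f x)) (cmod (g x)) powr q"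
      by (simp add: powr_mult)
    also have "\<dots> \<le> 2 powr q * (cmod (f x) powr q + cmod (g x) powr q)"
      by (intro mult_left_mono) (auto simp: max_def)
    finally show "ennreal (cmod (f x + g x) powr q) \<le>
        ennreal (2 powr q) * (ennreal (cmod (f x) powr q) + ennreal (cmod (g x) powr q))"
      by (simp add: ennreal_leI flip: ennreal_mult ennreal_plus)
  qed
  also have "\<dots> = ennreal (2 powr q) * (?I f + ?I g)"
    by (subst nn_integral_cmult) (auto simp: nn_integral_add)
  also have "\<dots> \<le> ennreal (2 powr q) * (2 * max (?I f) (?I g))"
    by (intro mult_left_mono) (auto simp: mult_2 intro!: add_mono)
  \<comment> \<open>The factor 2 is absorbed into \<open>2 powr q\<close>, since
    \<open>1 \<le> q\<close>; the total factor becomes \<open>4 powr q\<close>, whose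
    \<open>q\<close>-th root is 4 for every \<open>q\<close>.\<close>
  also have "\<dots> \<le> ennreal (2 powr q) * (ennreal (2 powr q) * max (?I f) (?I g))"
  proof -
    have "(2::real) powr 1 \<le> 2 powr q"
      using q by (intro powr_mono) auto
    then have "ennreal 2 \<le> ennreal (2 powr q)"
      by (intro ennreal_leI) simp
    then show ?thesis
      by (intro mult_left_mono mult_right_mono) auto
  qed
  also have "\<dots> = ennreal (4 powr q) * max (?I f) (?I g)"
    by (simp flip: mult.assoc ennreal_mult powr_mult)
  finally have "ennroot q (?I (\<lambda>x. f x + g x)) \<le> ennroot q (ennreal (4 powr q) * max (?I f) (?I g))"
    using q by (intro ennroot_mono) simp_all
  also have "\<dots> = 4 * ennroot q (max (?I f) (?I g))"
    using ennroot_mult[of q 4] q by simp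
  also have "ennroot q (max (?I f) (?I g)) = max (ennroot q (?I f)) (ennroot q (?I g))"
    using q by (intro max_of_mono[symmetric]) (auto intro!: monoI ennroot_mono)
  finally show ?thesis
    using False by (simp add: Lp_norm_eq_ennroot q_def)
qed

section \<open>Membership in the spaces\<close>

lemma Lp_measurable: "f \<in> Lp M p \<Longrightarrow> f \<in> borel_measurable M"
  by (simp add: Lp_def)

lemma Lp_dominated:
  assumes "1 \<le> p" "f \<in> Lp M p" "g \<in> borel_measurable M" "0 < K"
    and "AE x in M. cmod (g x) \<le> K * cmod (f x)"
  shows "g \<in> Lp M p"
  using Lp_norm_le[OF assms(1,3) Lp_measurable[OF assms(2)] assms(4,5)] assms(2,3)
  by (auto simp: Lp_def ennreal_mult_less_top intro: le_less_trans)

lemma Lp_add: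
  assumes "1 \<le> p" "f \<in> Lp M p" "g \<in> Lp M p"
  shows "(\<lambda>x. f x + g x) \<in> Lp M p"
proof -
  have "4 * max (Lp_norm M p f) (Lp_norm M p g) < \<infinity>"
    using assms by (auto simp: Lp_def ennreal_mult_less_top max_def)
  then show ?thesis
    using Lp_norm_add_le[of p f M g] assms by (auto simp: Lp_def intro: le_less_trans)
qed

lemma Lp_cmult:
  assumes "1 \<le> p" "f \<in> Lp M p"
  shows "(\<lambda>x. c * f x) \<in> Lp M p"
proof (rule Lp_dominated[OF assms, of _ "cmod c + 1"])
  have [measurable]: "f \<in> borel_measurable M"
    using assms by (simp add: Lp_def)
  show "(\<lambda>x. c * f x) \<in> borel_measurable M"
    by measurable
  show "AE x in M. cmod (c * f x) \<le> (cmod c + 1) * cmod (f x)"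
    by (simp add: norm_mult mult_right_mono)
qed (simp add: add_nonneg_pos)

lemma bounded_finite_support_in_Lp:
  assumes p: "1 \<le> p" and A [measurable]: "A \<in> sets M" and fin: "emeasure M A < \<infinity>"
    and [measurable]: "f \<in> borel_measurable M" and le: "\<And>x. cmod (f x) \<le> indicator A x"
  shows "f \<in> Lp M p"
proof (cases "p = \<infinity>")
  case True
  have "esssup M (\<lambda>x. ennreal (cmod (f x))) \<le> 1"
  proof (rule esssup_I)
    have "cmod (f x) \<le> 1" for x
      using le[of x] by (cases "x \<in> A") auto
    then show "AE x in M. ennreal (cmod (f x)) \<le> 1"
      by simp
  qed measurable
  then show ?thesis
    using True by (auto simp: Lp_def Lp_norm_def intro: le_less_trans)
next
  case False
  have "(\<integral>\<^sup>+ x. ennreal (cmod (f x) powr enn2real p) \<partial>M) \<le> (\<integral>\<^sup>+ x. indicator A x \<partial>M)"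
  proof (rule nn_integral_mono)
    fix x
    have "cmod (f x) powr enn2real p \<le> indicator A x"
      using le[of x] enn2real_ge_1[OF p False]
      by (auto simp: indicator_def powr_le1 split: if_splits)
    then show "ennreal (cmod (f x) powr enn2real p) \<le> indicator A x"
      by (auto simp: indicator_def split: if_splits)
  qed
  then have "(\<integral>\<^sup>+ x. ennreal (cmod (f x) powr enn2real p) \<partial>M) < \<infinity>"
    using fin by (auto intro: le_less_trans)
  then show ?thesis
    using False by (auto simp: Lp_def Lp_norm_def Let_def)
qed

section \<open>Points of the essential range\<close>

text \<open>If every point of \<open>U\<close> had a ball that \<open>h\<close> avoids almost
  everywhere, then by the Lindelof property countably many of these balls would cover
  \<open>U\<close>, and \<open>h\<close> would avoid \<open>U\<close> almost everywhere.\<close>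

lemma ex_ess_range_point:
  fixes h :: "'a \<Rightarrow> 'b::{metric_space, second_countable_topology}"
  assumes U: "open U" and not_null: "\<not> (AE x in M. h x \<notin> U)"
  obtains z where "z \<in> U" "\<And>e. 0 < e \<Longrightarrow> \<not> (AE x in M. e \<le> dist (h x) z)"
proof -
  have False if "\<And>z. z \<in> U \<Longrightarrow> \<exists>e>0. AE x in M. e \<le> dist (h x) z"
  proof -
    have "\<exists>e. \<forall>z\<in>U. 0 < e z \<and> (AE x in M. e z \<le> dist (h x) z)"
      using that by (intro bchoice ballI) blast
    then obtain e where e: "\<And>z. z \<in> U \<Longrightarrow> 0 < e z" "\<And>z. z \<in> U \<Longrightarrow> AE x in M. e z \<le> dist (h x) z"
      by blast
    obtain \<B> where \<B>: "\<B> \<subseteq> (\<lambda>z. ball z (e z)) ` U" "countable \<B>" "\<Union>\<B> = (\<Union>z\<in>U. ball z (e z))"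
      using Lindelof[of "(\<lambda>z. ball z (e z)) ` U"] by auto
    have "AE x in M. \<forall>B\<in>\<B>. h x \<notin> B"
    proof (subst AE_ball_countable[OF \<B>(2)], intro ballI)
      fix B assume "B \<in> \<B>"
      then obtain z where "z \<in> U" "B = ball z (e z)"
        using \<B>(1) by auto
      then show "AE x in M. h x \<notin> B"
        using e(2)[of z] by (auto simp: dist_commute not_less)
    qed
    moreover have U: "U \<subseteq> \<Union>\<B>"
      using e(1) \<B>(3) by auto
    ultimately have "AE x in M. h x \<notin> U"
      by (elim eventually_mono) (use U in blast)
    then show False
      using not_null by contradiction
  qed
  then show thesis
    using that by blast
qed


subsection \<open>The operator \<open>M\<^sub>w E M\<^sub>u\<close>\<close>

text \<open>The assumption \<open>mult_dom\<close> expresses that \<open>E (u f)\<close> is defined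
  for every \<open>f\<close> in the space, which is implicit in speaking of the operator.\<close>

locale bounded_weighted_cond_exp = sigma_finite_subalgebra M F for M F :: "'a measure" +
  fixes u w :: "'a \<Rightarrow> complex" and p :: ennreal
  assumes p: "1 \<le> p"
    and u_dom: "u \<in> cond_exp_dom M F"
    and w_measurable [measurable]: "w \<in> borel_measurable M"
    and mult_dom: "f \<in> Lp M p \<Longrightarrow> (\<lambda>x. u x * f x) \<in> cond_exp_dom M F"
    and bounded: "Lp_bounded_operator M p (weighted_cond_exp M F w u)"
begin

abbreviation T :: "('a \<Rightarrow> complex) \<Rightarrow> 'a \<Rightarrow> complex" where
  "T \<equiv> weighted_cond_exp M F w u"

section \<open>Test functions adapted to the phase of \<open>u\<close>\<close>

definition h :: "'a \<Rightarrow> complex" where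
  "h = complex_cond_exp M F (\<lambda>x. u x * w x)"

definition N :: "'a \<Rightarrow> real" where
  "N x = enn2real (nn_cond_exp M F (\<lambda>y. ennreal (cmod (u y))) x)"

text \<open>This is \<open>1_C cnj (sgn u)\<close>; it turns \<open>u\<close> into
  \<open>|u|\<close> on \<open>C\<close>. Where \<open>u\<close> vanishes, division by zero makes
  the value 0.\<close>

definition unphase :: "'a set \<Rightarrow> 'a \<Rightarrow> complex" where
  "unphase C x = indicator C x * cnj (u x / complex_of_real (cmod (u x)))"

lemma u_measurable [measurable]: "u \<in> borel_measurable M"
  using u_dom by (simp add: cond_exp_dom_def)

lemma h_measurable [measurable]: "h \<in> borel_measurable F" "h \<in> borel_measurable M"
  unfolding h_def by measurable

lemma N_measurable [measurable]: "N \<in> borel_measurable F" "N \<in> borel_measurable M"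
  unfolding N_def by measurable

lemma sets_F_M: "C \<in> sets F \<Longrightarrow> C \<in> sets M"
  using subalg by (auto simp: subalgebra_def)

lemma ennreal_N: "AE x in M. ennreal (N x) = nn_cond_exp M F (\<lambda>y. ennreal (cmod (u y))) x"
  using u_dom by (auto simp: cond_exp_dom_def N_def elim: eventually_mono)

lemma N_eq_0_imp: "AE x in M. N x = 0 \<longrightarrow> u x = 0"
proof -
  have "AE x in M. nn_cond_exp M F (\<lambda>y. ennreal (cmod (u y))) x = 0 \<longrightarrow> ennreal (cmod (u x)) = 0"
    by (rule nn_cond_exp_eq_0_imp) measurable
  then show ?thesis
    using ennreal_N by eventually_elim auto
qed

lemma unphase_in_Lp:
  assumes C: "C \<in> sets F" "emeasure M C < \<infinity>"
  shows "unphase C \<in> Lp M p"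
proof (rule bounded_finite_support_in_Lp[OF p sets_F_M[OF C(1)] C(2)])
  have [measurable]: "C \<in> sets M"
    using C by (simp add: sets_F_M)
  show "unphase C \<in> borel_measurable M"
    unfolding unphase_def by (intro borel_measurable_times borel_measurable_indicator
      borel_measurable_continuous_on[OF continuous_on_cnj[OF continuous_on_id], simplified]) measurable
  show "cmod (unphase C x) \<le> indicator C x" for x
    by (cases "x \<in> C") (auto simp: unphase_def norm_mult norm_divide)
qed

lemma u_mult_unphase: "u x * unphase C x = indicator C x * complex_of_real (cmod (u x))"
  by (cases "u x = 0") (auto simp: unphase_def complex_norm_square[symmetric] power2_eq_square field_simps)

text \<open>Multiplied by \<open>u\<close>, the test function becomes \<open>1_C |u|\<close>, and
  \<open>1_C\<close> leaves the expectation because \<open>C\<close> belongs to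
  \<open>F\<close>.\<close>

lemma T_unphase:
  assumes [measurable]: "C \<in> sets F"
  shows "AE x in M. T (unphase C) x = indicator C x * (w x * complex_of_real (N x))"
proof -
  have "(\<lambda>y. complex_of_real (cmod (u y))) \<in> cond_exp_dom M F"
    using u_dom by (simp add: cond_exp_dom_def)
  then have "AE x in M. complex_cond_exp M F (\<lambda>y. indicator C y * complex_of_real (cmod (u y))) x =
      indicator C x * complex_cond_exp M F (\<lambda>y. complex_of_real (cmod (u y))) x"
    by (intro complex_cond_exp_mult) measurable
  moreover have "AE x in M. complex_cond_exp M F (\<lambda>y. complex_of_real (cmod (u y))) x = complex_of_real (N x)"
    unfolding N_def by (rule complex_cond_exp_of_real_nonneg) auto
  ultimately show ?thesis
    by eventually_elim (simp add: weighted_cond_exp_def u_mult_unphase)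
qed

text \<open>Sigma-finiteness of the restricted measure is what puts the covering sets into
  \<open>F\<close>, so that their indicators can be pulled out of \<open>E\<close>.\<close>

lemma finite_cover:
  obtains A :: "nat \<Rightarrow> 'a set"
  where "\<And>i. A i \<in> sets F" "\<And>i. emeasure M (A i) < \<infinity>" "(\<Union>i. A i) = space M"
proof -
  obtain A :: "nat \<Rightarrow> 'a set" where A: "range A \<subseteq> sets (restr_to_subalg M F)"
    "(\<Union>i. A i) = space (restr_to_subalg M F)" "\<And>i. emeasure (restr_to_subalg M F) (A i) \<noteq> \<infinity>"
    using sigma_finite_measure.sigma_finite[OF sigma_fin_subalg] by metis
  then have "A i \<in> sets F" for i
    using sets_restr_to_subalg[OF subalg] by auto
  then show thesis
    using A that emeasure_restr_to_subalg[OF subalg]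
    by (metis infinity_ennreal_def space_restr_to_subalg top.not_eq_extremum)
qed

text \<open>By \<open>T_unphase\<close>, \<open>w N\<close> vanishes on each piece of
  \<open>B\<close> of finite measure, hence almost everywhere on \<open>B\<close>; where
  \<open>N\<close> is 0, so is \<open>u\<close>.\<close>

lemma uw_eq_0_if_T_unphase_eq_0:
  assumes B: "B \<in> sets F"
    and zero: "\<And>C. C \<in> sets F \<Longrightarrow> C \<subseteq> B \<Longrightarrow> emeasure M C < \<infinity> \<Longrightarrow> AE x in M. T (unphase C) x = 0"
  shows "AE x in M. x \<in> B \<longrightarrow> u x * w x = 0"
proof -
  obtain A :: "nat \<Rightarrow> 'a set" where A: "\<And>i. A i \<in> sets F" "\<And>i. emeasure M (A i) < \<infinity>" "(\<Union>i. A i) = space M"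
    using finite_cover by blast
  have "AE x in M. x \<in> A i \<inter> B \<longrightarrow> w x * complex_of_real (N x) = 0" for i
  proof -
    have C: "A i \<inter> B \<in> sets F"
      using A(1) B by auto
    have "emeasure M (A i \<inter> B) \<le> emeasure M (A i)"
      using A(1) by (intro emeasure_mono) (auto simp: sets_F_M)
    then have "emeasure M (A i \<inter> B) < \<infinity>"
      using A(2) by (rule le_less_trans)
    then have "AE x in M. T (unphase (A i \<inter> B)) x = 0"
      using C by (intro zero) auto
    then show ?thesis
      using T_unphase[OF C] by eventually_elim (auto simp: indicator_def split: if_splits)
  qed
  then have "AE x in M. \<forall>i. x \<in> A i \<inter> B \<longrightarrow> w x * complex_of_real (N x) = 0"
    unfolding AE_all_countable by blast
  then show ?thesis
    using N_eq_0_imp AE_space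
  proof eventually_elim
    case (elim x)
    then show ?case
      using A(3) by fastforce
  qed
qed

section \<open>Finiteness of \<open>E |uw|\<close> and the action of \<open>T\<close> on its
  range\<close>

lemma T_in_Lp: "f \<in> Lp M p \<Longrightarrow> T f \<in> Lp M p"
  using bounded by (simp add: Lp_bounded_operator_def)

text \<open>On \<open>A i\<close> the function \<open>T (unphase (A i))\<close> equals
  \<open>w N\<close>. It lies in the space, so \<open>mult_dom\<close> makes
  \<open>E (|u| N |w|) = N E |uw|\<close> finite there. Dividing by \<open>N\<close> settles the
  points where \<open>N\<close> is nonzero.\<close>

lemma uw_dom: "(\<lambda>x. u x * w x) \<in> cond_exp_dom M F"
proof -
  let ?E = "nn_cond_exp M F"
  let ?uw = "\<lambda>y. ennreal (cmod (u y * w y))"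
  obtain A :: "nat \<Rightarrow> 'a set" where A: "\<And>i. A i \<in> sets F" "\<And>i. emeasure M (A i) < \<infinity>" "(\<Union>i. A i) = space M"
    using finite_cover by blast
  have "AE x in M. x \<in> A i \<longrightarrow> ennreal (N x) * ?E ?uw x < \<infinity>" for i
  proof -
    have [measurable]: "A i \<in> sets F" "A i \<in> sets M"
      using A(1) sets_F_M by auto
    have TL: "T (unphase (A i)) \<in> Lp M p"
      using A by (intro T_in_Lp unphase_in_Lp)
    then have [measurable]: "T (unphase (A i)) \<in> borel_measurable M"
      by (rule Lp_measurable)
    have "AE x in M. ?E (\<lambda>y. ennreal (cmod (u y * T (unphase (A i)) y))) x < \<infinity>"
      using mult_dom[OF TL] by (simp add: cond_exp_dom_def)
    moreover have "AE x in M. ?E (\<lambda>y. ennreal (cmod (u y * T (unphase (A i)) y))) x =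
        ?E (\<lambda>y. (indicator (A i) y * ennreal (N y)) * ?uw y) x"
    proof (rule nn_cond_exp_cong)
      show "AE x in M. ennreal (cmod (u x * T (unphase (A i)) x)) =
          (indicator (A i) x * ennreal (N x)) * ?uw x"
        using T_unphase[OF A(1)[of i]]
      proof eventually_elim
        case (elim x)
        show ?case
          unfolding elim
          by (auto simp: indicator_def norm_mult N_def ac_simps simp flip: ennreal_mult)
      qed
    qed measurable
    moreover have "AE x in M. (indicator (A i) x * ennreal (N x)) * ?E ?uw x =
        ?E (\<lambda>y. (indicator (A i) y * ennreal (N y)) * ?uw y) x"
      by (rule nn_cond_exp_prod) measurable
    ultimately show ?thesis
      by eventually_elim (auto simp: indicator_def split: if_splits)
  qed
  then have "AE x in M. \<forall>i. x \<in> A i \<longrightarrow> ennreal (N x) * ?E ?uw x < \<infinity>"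
    unfolding AE_all_countable by blast
  \<comment> \<open>Where \<open>N\<close> is 0, the finite product gives no information, as 0 times
    infinity is 0. But \<open>u\<close> vanishes on this \<open>F\<close>-measurable set, hence so
    does \<open>E |uw|\<close>.\<close>
  moreover have "AE x in M. N x = 0 \<longrightarrow> ?E ?uw x = 0"
  proof -
    let ?Z = "\<lambda>x. if N x = 0 then 1 else 0 :: ennreal"
    have "AE x in M. ?Z x * ?E ?uw x = ?E (\<lambda>y. ?Z y * ?uw y) x"
      by (rule nn_cond_exp_prod) measurable
    moreover have "AE x in M. ?E (\<lambda>y. ?Z y * ?uw y) x = ?E (\<lambda>_. 0) x"
      by (rule nn_cond_exp_cong) (use N_eq_0_imp in \<open>auto elim: eventually_mono\<close>)
    moreover have "AE x in M. 0 = ?E (\<lambda>_. 0) x"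
      by (rule nn_cond_exp_F_meas) simp
    ultimately show ?thesis
      by eventually_elim auto
  qed
  ultimately have "AE x in M. ?E ?uw x < \<infinity>"
    using AE_space
  proof eventually_elim
    case (elim x)
    obtain i where "x \<in> A i"
      using elim(3) A(3) by auto
    then have "ennreal (N x) * ?E ?uw x < \<infinity>"
      using elim(1) by blast
    moreover have "0 \<le> N x"
      by (simp add: N_def)
    ultimately show ?case
      using elim(2) by (cases "N x = 0") (auto simp: ennreal_mult_less_top)
  qed
  then show ?thesis
    by (simp add: cond_exp_dom_def)
qed

text \<open>The factor \<open>\<phi> E (u f)\<close> is \<open>F\<close>-measurable and leaves the
  outer expectation; the remaining \<open>u w\<close> has expectation \<open>h\<close>.\<close>

lemma T_mult:
  assumes [measurable]: "\<phi> \<in> borel_measurable F" and f: "f \<in> Lp M p"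
  shows "AE x in M. T (\<lambda>y. \<phi> y * T f y) x = h x * (\<phi> x * T f x)"
proof -
  let ?E = "complex_cond_exp M F"
  have "AE x in M. ?E (\<lambda>y. (\<phi> y * ?E (\<lambda>y. u y * f y) y) * (u y * w y)) x =
      (\<phi> x * ?E (\<lambda>y. u y * f y) x) * ?E (\<lambda>y. u y * w y) x"
    by (rule complex_cond_exp_mult[OF _ uw_dom]) measurable
  moreover have "(\<lambda>y. (\<phi> y * ?E (\<lambda>y. u y * f y) y) * (u y * w y)) =
      (\<lambda>y. u y * (\<phi> y * T f y))"
    by (simp add: weighted_cond_exp_def fun_eq_iff)
  ultimately have "AE x in M. ?E (\<lambda>y. u y * (\<phi> y * T f y)) x =
      (\<phi> x * ?E (\<lambda>y. u y * f y) x) * ?E (\<lambda>y. u y * w y) x"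
    by simp
  then show ?thesis
    by eventually_elim (simp add: weighted_cond_exp_def h_def)
qed

lemma T_T:
  assumes "f \<in> Lp M p"
  shows "AE x in M. T (T f) x = h x * T f x"
  using T_mult[of "\<lambda>_. 1", OF _ assms] by simp

section \<open>Linearity of \<open>T\<close> and its resolvent outside the disc of radius
  \<open>Lp_norm M \<infinity> h\<close>\<close>

lemma T_cong: "f \<in> Lp M p \<Longrightarrow> g \<in> Lp M p \<Longrightarrow> AE x in M. f x = g x \<Longrightarrow> AE x in M. T f x = T g x"
  using bounded by (simp add: Lp_bounded_operator_def)

lemma T_add: "f \<in> Lp M p \<Longrightarrow> g \<in> Lp M p \<Longrightarrow> AE x in M. T (\<lambda>y. f y + g y) x = T f x + T g x"
  using bounded by (simp add: Lp_bounded_operator_def)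

lemma T_cmult: "f \<in> Lp M p \<Longrightarrow> AE x in M. T (\<lambda>y. c * f y) x = c * T f x"
  using bounded by (simp add: Lp_bounded_operator_def)

lemma T_lincomb:
  assumes "f \<in> Lp M p" "g \<in> Lp M p"
  shows "AE x in M. T (\<lambda>y. a * f y + b * g y) x = a * T f x + b * T g x"
  using T_add[OF Lp_cmult[OF p assms(1)] Lp_cmult[OF p assms(2)], of a b]
    T_cmult[OF assms(1), of a] T_cmult[OF assms(2), of b]
  by eventually_elim simp

lemma Lp_lincomb: "f \<in> Lp M p \<Longrightarrow> g \<in> Lp M p \<Longrightarrow> (\<lambda>y. a * f y + b * g y) \<in> Lp M p"
  by (intro Lp_add Lp_cmult p)

lemma T_shift_in_Lp: "f \<in> Lp M p \<Longrightarrow> (\<lambda>x. T f x - l * f x) \<in> Lp M p"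
  using Lp_lincomb[OF T_in_Lp, of f f 1 "- l"] by simp

text \<open>If \<open>g = T f - l f\<close>, then \<open>T_T\<close> gives
  \<open>T g = (h - l) T f\<close>. Hence \<open>T f = k T g\<close> with
  \<open>k = 1 / (h - l)\<close>, and solving for \<open>f\<close> gives
  \<open>f = (k T g - g) / l\<close>, which is \<open>S g\<close>.\<close>

lemma shift_invertible:
  assumes l: "Lp_norm M \<infinity> h < ennreal (cmod l)"
  shows "Lp_invertible M p (\<lambda>f x. T f x - l * f x)"
proof -
  obtain H where H: "Lp_norm M \<infinity> h = ennreal H" "0 \<le> H"
    using l by (cases "Lp_norm M \<infinity> h") auto
  \<comment> \<open>The gap \<open>d\<close> is an essential lower bound of \<open>|h - l|\<close>,
    so \<open>k\<close> below is essentially bounded by \<open>1 / d\<close>.\<close>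
  define d where "d = cmod l - H"
  have d: "0 < d"
    using l H by (simp add: d_def ennreal_less_iff)
  have l0: "l \<noteq> 0"
    using l by auto
  have "AE x in M. ennreal (cmod (h x)) \<le> ennreal H"
    using esssup_AE[of "\<lambda>x. ennreal (cmod (h x))" M] H(1) by (simp add: Lp_norm_def)
  then have far: "AE x in M. d \<le> cmod (h x - l)"
  proof eventually_elim
    case (elim x)
    then have "cmod (h x) \<le> H"
      using H(2) by simp
    then show ?case
      using norm_triangle_ineq2[of l "h x"] by (simp add: d_def norm_minus_commute)
  qed
  then have nonzero: "AE x in M. h x - l \<noteq> 0"
    by eventually_elim (use d in auto)
  define k where "k = (\<lambda>x. 1 / (h x - l))"
  have [measurable]: "k \<in> borel_measurable F" "k \<in> borel_measurable M"
    by (auto simp: k_def)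
  have k_le: "AE x in M. cmod (k x) \<le> 1 / d"
    using far by eventually_elim (use d in \<open>simp add: k_def norm_divide frac_le\<close>)
  define S where "S = (\<lambda>f x. 1 / l * (k x * T f x) + - (1 / l) * f x)"
  have kT_le: "AE x in M. cmod (k x * T f x) \<le> 1 / d * cmod (T f x)" for f
    using k_le by eventually_elim (simp only: norm_mult mult_right_mono norm_ge_zero)
  have kT: "(\<lambda>x. k x * T f x) \<in> Lp M p" if "f \<in> Lp M p" for f
  proof -
    have [measurable]: "T f \<in> borel_measurable M"
      using that by (rule Lp_measurable[OF T_in_Lp])
    show ?thesis
      using d kT_le by (intro Lp_dominated[OF p T_in_Lp[OF that], of _ "1 / d"]) auto
  qed
  have S_in_Lp: "S f \<in> Lp M p" if "f \<in> Lp M p" for f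
    unfolding S_def by (intro Lp_lincomb kT that)
  obtain C where C: "0 \<le> C" "\<And>f. f \<in> Lp M p \<Longrightarrow> Lp_norm M p (T f) \<le> ennreal C * Lp_norm M p f"
    using bounded by (auto simp: Lp_bounded_operator_def)
  define c where "c = 1 / cmod l"
  have c: "0 < c"
    using l0 by (simp add: c_def)
  have "Lp_bounded_operator M p S"
    unfolding Lp_bounded_operator_def
  proof (intro conjI ballI allI impI)
    show "S f \<in> Lp M p" if "f \<in> Lp M p" for f
      by (rule S_in_Lp[OF that])
  next
    fix f g assume fg: "f \<in> Lp M p" "g \<in> Lp M p"
    show "AE x in M. S f x = S g x" if "AE x in M. f x = g x"
      using T_cong[OF fg that] that by eventually_elim (simp add: S_def)
    show "AE x in M. S (\<lambda>y. f y + g y) x = S f x + S g x"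
      using T_add[OF fg] by eventually_elim (simp add: S_def algebra_simps add_divide_distrib)
  next
    fix a f assume f: "f \<in> Lp M p"
    show "AE x in M. S (\<lambda>y. a * f y) x = a * S f x"
      using T_cmult[OF f, of a] by eventually_elim (simp add: S_def algebra_simps)
  next
    show "\<exists>C\<ge>0. \<forall>f\<in>Lp M p. Lp_norm M p (S f) \<le> ennreal C * Lp_norm M p f"
    \<comment> \<open>The 4 comes from \<open>Lp_norm_add_le\<close>; the two summands bound
      \<open>k T f / l\<close> and \<open>f / l\<close>, and their sum bounds the maximum.\<close>
    proof (intro exI[of _ "4 * (c / d * C + c)"] conjI ballI)
      show "0 \<le> 4 * (c / d * C + c)"
        using C(1) c d by simp
      fix f assume f: "f \<in> Lp M p"
      let ?n = "Lp_norm M p f"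
      have [measurable]: "f \<in> borel_measurable M" "T f \<in> borel_measurable M"
        using Lp_measurable[OF f] Lp_measurable[OF T_in_Lp[OF f]] by auto
      have "Lp_norm M p (\<lambda>x. 1 / l * (k x * T f x)) \<le> ennreal (c / d) * Lp_norm M p (T f)"
      proof (rule Lp_norm_le[OF p])
        show "AE x in M. cmod (1 / l * (k x * T f x)) \<le> c / d * cmod (T f x)"
          using kT_le[of f]
        proof eventually_elim
          case (elim x)
          then have "c * cmod (k x * T f x) \<le> c * (1 / d * cmod (T f x))"
            using c by (intro mult_left_mono) auto
          then show ?case
            by (simp add: c_def norm_mult norm_divide)
        qed
      qed (use c d in auto)
      also have "\<dots> \<le> ennreal (c / d) * (ennreal C * ?n)"
        by (intro mult_left_mono C f) simp
      also have "\<dots> = ennreal (c / d * C) * ?n"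
        using c d C(1) by (subst ennreal_mult) (simp_all add: mult.assoc)
      finally have 1: "Lp_norm M p (\<lambda>x. 1 / l * (k x * T f x)) \<le> ennreal (c / d * C) * ?n" .
      have 2: "Lp_norm M p (\<lambda>x. - (1 / l) * f x) \<le> ennreal c * ?n"
        by (rule Lp_norm_le[OF p]) (use c in \<open>auto simp: c_def norm_mult norm_divide\<close>)
      have "Lp_norm M p (S f) \<le> 4 * max (Lp_norm M p (\<lambda>x. 1 / l * (k x * T f x))) (Lp_norm M p (\<lambda>x. - (1 / l) * f x))"
        unfolding S_def by (rule Lp_norm_add_le[OF p]) measurable
      also have "\<dots> \<le> 4 * (ennreal (c / d * C) * ?n + ennreal c * ?n)"
        using 1 2 by (intro mult_left_mono max.boundedI) (auto intro: add_increasing add_increasing2)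
      also have "\<dots> = 4 * ((ennreal (c / d * C) + ennreal c) * ?n)"
        by (simp only: distrib_right)
      also have "\<dots> = 4 * (ennreal (c / d * C + c) * ?n)"
        using c d C(1) by (subst ennreal_plus) auto
      also have "\<dots> = ennreal (4 * (c / d * C + c)) * ?n"
        by (simp only: ennreal_mult'[of 4] ennreal_numeral mult.assoc zero_le_numeral)
      finally show "Lp_norm M p (S f) \<le> ennreal (4 * (c / d * C + c)) * ?n" .
    qed
  qed
  moreover have "AE x in M. S (\<lambda>x. T f x - l * f x) x = f x" if f: "f \<in> Lp M p" for f
  proof -
    have "AE x in M. T (\<lambda>x. T f x - l * f x) x = T (T f) x - l * T f x"
      using T_lincomb[OF T_in_Lp[OF f] f, of 1 "- l"] by simp
    then show ?thesis
      using T_T[OF f] nonzero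
    proof eventually_elim
      case (elim x)
      \<comment> \<open>Both facts are polynomial relations in \<open>1 / l\<close> and
        \<open>k x\<close>, from which the goal follows by ring identities alone.\<close>
      have "1 / l * l = 1" "k x * (h x - l) = 1"
        using l0 elim(3) by (auto simp: k_def)
      then show ?case
        unfolding S_def elim(1,2) by algebra
    qed
  qed
  \<comment> \<open>Since \<open>h k - 1 = l k\<close>, both \<open>T (S f)\<close> and
    \<open>l S f + f\<close> reduce to \<open>k T f\<close>.\<close>
  moreover have "AE x in M. T (S f) x - l * S f x = f x" if f: "f \<in> Lp M p" for f
  proof -
    have "AE x in M. T (S f) x = 1 / l * T (\<lambda>x. k x * T f x) x + - (1 / l) * T f x"
      unfolding S_def by (rule T_lincomb[OF kT[OF f] f])
    moreover have "AE x in M. T (\<lambda>x. k x * T f x) x = h x * (k x * T f x)"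
      by (rule T_mult[OF _ f]) measurable
    ultimately show ?thesis
      using nonzero
    proof eventually_elim
      case (elim x)
      have "1 / l * l = 1" "k x * (h x - l) = 1"
        using l0 elim(3) by (auto simp: k_def)
      then show ?case
        unfolding elim(1,2) unfolding S_def by algebra
    qed
  qed
  ultimately show ?thesis
    unfolding Lp_invertible_def by blast
qed

section \<open>Approximate eigenvectors at nonzero points of the essential range\<close>

text \<open>An inverse of norm at most \<open>C\<close> would force
  \<open>|g| \<le> C |T g - z g|\<close> in norm for all \<open>g\<close>, while a nonzero
  \<open>g\<close> in the range of \<open>T\<close>, supported where \<open>h\<close> is within
  \<open>e\<close> of \<open>z\<close>, has \<open>|T g - z g| \<le> e |g|\<close>.\<close>

lemma not_shift_invertible:
  assumes z: "z \<noteq> 0" and ess: "\<And>e. 0 < e \<Longrightarrow> \<not> (AE x in M. e \<le> dist (h x) z)"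
  shows "\<not> Lp_invertible M p (\<lambda>f x. T f x - z * f x)"
proof
  assume "Lp_invertible M p (\<lambda>f x. T f x - z * f x)"
  then obtain S where S: "Lp_bounded_operator M p S"
    "\<And>f. f \<in> Lp M p \<Longrightarrow> AE x in M. S (\<lambda>x. T f x - z * f x) x = f x"
    by (auto simp: Lp_invertible_def)
  obtain C where C: "0 \<le> C" "\<And>f. f \<in> Lp M p \<Longrightarrow> Lp_norm M p (S f) \<le> ennreal C * Lp_norm M p f"
    using S(1) by (auto simp: Lp_bounded_operator_def)
  \<comment> \<open>The second bound gives \<open>C * e < 1\<close>. The first keeps
    \<open>h\<close> away from 0 on \<open>B\<close>, which yields a nonzero
    \<open>g\<close>.\<close>
  define e where "e = min (cmod z) (1 / (C + 1))"
  have e: "0 < e" "e \<le> cmod z"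
    using z C(1) by (auto simp: e_def)
  have "C * e \<le> C * (1 / (C + 1))"
    using C(1) by (intro mult_left_mono) (auto simp: e_def)
  also have "\<dots> < 1"
    using C(1) by (simp add: field_simps)
  finally have Ce: "C * e < 1" .
  define B where "B = {x \<in> space M. dist (h x) z < e}"
  have "B = {x \<in> space F. dist (h x) z < e}"
    using subalg by (simp add: B_def subalgebra_def)
  then have B [measurable]: "B \<in> sets F"
    by simp
  have [measurable]: "B \<in> sets M"
    using B by (rule sets_F_M)
  \<comment> \<open>If all candidates vanished, then \<open>u w\<close> would be 0 on
    \<open>B\<close>, so \<open>1_B h = E (1_B u w) = 0\<close>. A point of \<open>B\<close> with
    \<open>h x = 0\<close> would have distance \<open>cmod z\<close> from \<open>z\<close>, at least
    \<open>e\<close>; hence \<open>B\<close> would be null, against \<open>ess\<close>.\<close>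
  obtain D where D: "D \<in> sets F" "D \<subseteq> B" "emeasure M D < \<infinity>" "\<not> (AE x in M. T (unphase D) x = 0)"
  proof (rule ccontr)
    assume "\<not> thesis"
    then have uw: "AE x in M. x \<in> B \<longrightarrow> u x * w x = 0"
      using that by (intro uw_eq_0_if_T_unphase_eq_0[OF B]) blast
    have "AE x in M. complex_cond_exp M F (\<lambda>y. indicator B y * (u y * w y)) x = indicator B x * h x"
      unfolding h_def by (rule complex_cond_exp_mult[OF _ uw_dom]) measurable
    \<comment> \<open>That \<open>E 0 = 0\<close> is obtained by pulling out the constant 0.\<close>
    moreover have "AE x in M. complex_cond_exp M F (\<lambda>y. 0 * (u y * w y)) x = 0 * h x"
      unfolding h_def by (rule complex_cond_exp_mult[OF _ uw_dom]) measurable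
    moreover have "AE x in M. complex_cond_exp M F (\<lambda>y. indicator B y * (u y * w y)) x =
        complex_cond_exp M F (\<lambda>y. 0 * (u y * w y)) x"
      by (rule complex_cond_exp_cong) (use uw in \<open>auto elim!: eventually_mono simp: indicator_def\<close>)
    ultimately have "AE x in M. e \<le> dist (h x) z"
      using AE_space
    proof eventually_elim
      case (elim x)
      show ?case
      proof (cases "x \<in> B")
        case True
        then have "h x = 0"
          using elim by simp
        then show ?thesis
          using e by simp
      next
        case False
        then show ?thesis
          using elim(4) by (auto simp: B_def)
      qed
    qed
    then show False
      using ess[OF e(1)] by contradiction
  qed
  define g where "g = T (unphase D)"
  have fD: "unphase D \<in> Lp M p"
    by (rule unphase_in_Lp[OF D(1,3)])
  have g: "g \<in> Lp M p"
    unfolding g_def by (rule T_in_Lp[OF fD])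
  let ?R = "\<lambda>x. T g x - z * g x"
  have R: "?R \<in> Lp M p"
    by (rule T_shift_in_Lp[OF g])
  \<comment> \<open>On the range of \<open>T\<close> the operator multiplies by \<open>h\<close>, so
    the residual is \<open>(h - z) g\<close>; outside \<open>D\<close> the function \<open>g\<close>
    is 0.\<close>
  have R_le: "AE x in M. cmod (?R x) \<le> e * cmod (g x)"
    using T_T[OF fD] T_unphase[OF D(1)]
  proof eventually_elim
    case (elim x)
    have "?R x = (h x - z) * g x"
      using elim(1) by (simp add: g_def left_diff_distrib)
    then have "cmod (?R x) = dist (h x) z * cmod (g x)"
      by (simp add: norm_mult dist_norm)
    also have "\<dots> \<le> e * cmod (g x)"
    proof (cases "x \<in> D")
      case True
      then have "dist (h x) z < e"
        using D(2) by (auto simp: B_def)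
      then show ?thesis
        by (intro mult_right_mono) auto
    next
      case False
      then show ?thesis
        using elim(2) by (simp add: g_def)
    qed
    finally show ?case .
  qed
  have SR: "S ?R \<in> Lp M p"
    using S(1) R by (simp add: Lp_bounded_operator_def)
  have "AE x in M. cmod (g x) \<le> 1 * cmod (S ?R x)"
    using S(2)[OF g] by eventually_elim simp
  then have "Lp_norm M p g \<le> ennreal 1 * Lp_norm M p (S ?R)"
    by (intro Lp_norm_le[OF p] Lp_measurable[OF g] Lp_measurable[OF SR]) auto
  also have "\<dots> \<le> ennreal C * Lp_norm M p ?R"
    using C(2)[OF R] by simp
  also have "\<dots> \<le> ennreal C * (ennreal e * Lp_norm M p g)"
    by (intro mult_left_mono Lp_norm_le[OF p Lp_measurable[OF R] Lp_measurable[OF g] e(1) R_le]) simp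
  also have "\<dots> = ennreal (C * e) * Lp_norm M p g"
    using C(1) e by (simp add: ennreal_mult mult.assoc)
  finally have le: "Lp_norm M p g \<le> ennreal (C * e) * Lp_norm M p g" .
  \<comment> \<open>The norm of \<open>g\<close> is finite, so the inequality can be read in the
    reals and contradicts \<open>C * e < 1\<close> once \<open>r\<close> is nonzero.\<close>
  obtain r where r: "Lp_norm M p g = ennreal r" "0 \<le> r"
    using g by (cases "Lp_norm M p g") (auto simp: Lp_def)
  have "r \<noteq> 0"
    using Lp_norm_eq_0_imp[OF p Lp_measurable[OF g]] r D(4) by (auto simp: g_def)
  moreover have "r \<le> C * e * r"
    using le r C(1) e by (simp add: ennreal_le_iff flip: ennreal_mult)
  ultimately show False
    using Ce r(2) mult_strict_right_mono[OF Ce, of r] by simp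
qed

text \<open>The upper bound is the contrapositive of \<open>shift_invertible\<close>. If the lower
  bound failed, \<open>h\<close> would enter the open set \<open>U\<close> of numbers of modulus
  above the spectral radius on a set that is not null; \<open>U\<close> would then contain a point
  of the essential range, which is nonzero and so lies in the spectrum.\<close>

lemma spectral_radius: "Lp_spectral_radius M p T = Lp_norm M \<infinity> h"
proof (rule antisym)
  show "Lp_spectral_radius M p T \<le> Lp_norm M \<infinity> h"
    unfolding Lp_spectral_radius_def
  proof (rule SUP_least)
    fix l assume "l \<in> Lp_spectrum M p T"
    then show "ennreal (cmod l) \<le> Lp_norm M \<infinity> h"
      using shift_invertible[of l] by (auto simp: Lp_spectrum_def not_less[symmetric])
  qed
  show "Lp_norm M \<infinity> h \<le> Lp_spectral_radius M p T" (is "_ \<le> ?r")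
  proof (rule ccontr)
    assume "\<not> ?thesis"
    then have lt: "?r < esssup M (\<lambda>x. ennreal (cmod (h x)))"
      by (simp add: Lp_norm_def)
    define U where "U = {z. ?r < ennreal (cmod z)}"
    have "\<not> (AE x in M. h x \<notin> U)"
    proof
      assume "AE x in M. h x \<notin> U"
      then have "AE x in M. ennreal (cmod (h x)) \<le> ?r"
        by (simp add: U_def not_less)
      then have "esssup M (\<lambda>x. ennreal (cmod (h x))) \<le> ?r"
        by (intro esssup_I) measurable
      then show False
        using lt by simp
    qed
    moreover have "open U"
      unfolding U_def by (intro open_Collect_less continuous_on_ennreal continuous_intros)
    ultimately obtain z where z: "z \<in> U" "\<And>e. 0 < e \<Longrightarrow> \<not> (AE x in M. e \<le> dist (h x) z)"
      using ex_ess_range_point by metis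
    then have "z \<noteq> 0"
      by (auto simp: U_def)
    then have "z \<in> Lp_spectrum M p T"
      using not_shift_invertible z(2) by (auto simp: Lp_spectrum_def)
    then have "ennreal (cmod z) \<le> ?r"
      unfolding Lp_spectral_radius_def by (rule SUP_upper)
    then show False
      using z(1) by (simp add: U_def)
  qed
qed

end

theorem theorem3p5:
  fixes M F :: "'a measure" and u w :: "'a \<Rightarrow> complex" and p :: ennreal
  assumes "complete_measure M"
    and "sigma_finite_measure M"
    and "sigma_finite_subalgebra M F"
    and "u \<in> cond_exp_dom M F"
    and "w \<in> cond_exp_dom M F"
    and "1 \<le> p"
    and "\<And>f. f \<in> Lp M p \<Longrightarrow> (\<lambda>x. u x * f x) \<in> cond_exp_dom M F"
    and "Lp_bounded_operator M p (weighted_cond_exp M F w u)"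
  shows "(\<lambda>x. u x * w x) \<in> cond_exp_dom M F \<and>
    Lp_spectral_radius M p (weighted_cond_exp M F w u) =
      Lp_norm M \<infinity> (complex_cond_exp M F (\<lambda>x. u x * w x))"
proof -
  interpret sigma_finite_subalgebra M F
    by fact
  interpret bounded_weighted_cond_exp M F u w p
    by unfold_locales (use assms in \<open>auto simp: cond_exp_dom_def\<close>)
  show ?thesis
    using uw_dom spectral_radius by (simp add: h_def)
qed

end
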